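(* Fix $x\in\mathbb R^N$ and $\theta_\triangle$. Assume that for every nonempty $\mathcal S\subseteq\mathcal N$ and all $O_1,O_2\in\pi(\mathcal S)$, $f_c(x_{\mathcal S},O_1;\theta_\triangle)=f_c(x_{\mathcal S},O_2;\theta_\triangle)$. For every $M\ge1$ and every nonempty $\mathcal S\subseteq\mathcal N$ let $\mathcal D^{\mathcal S}_M$ consist of $M$ permutations drawn independently and uniformly at random from $\pi(\mathcal S)$, and let $\theta_\phi^{(M)}$ be a (random) parameter obtained by optimizing $L_s^{(i)}(x_{\mathcal S})$ for all subsets of $x$, i.e. such that for all nonempty $\mathcal S\subseteq\mathcal N$ and all $i\in\mathcal S$, at $\theta_\phi=\theta_\phi^{(M)}$, $$\frac{\partial L_s^{(i)}(x_{\mathcal S};\mathcal D_M^{\mathcal S})}{\partial\theta_\phi}=0,\qquad \frac{\partial\phi(x_{\mathcal S};\theta_\phi)_i}{\partial\theta_\phi}\neq0 .$$ Then, as the number $M$ of sampled permutations tends to infinity, $\phi(x;\theta_\phi^{(M)})$ converges to satisfy the Shapley value constraint for $f$: for every $i\in\mathcal N$, $$\phi(x;\theta_\phi^{(M)})_i-\frac1{N!}\sum_{O\in\pi(\mathcal N)}\sum_{k=1}^N\mathbb I\{O_k=i\}\bigl(f(x_{O_{1:k}};\theta_\phi^{(M)})-f(x_{O_{1:k-1}};\theta_\phi^{(M)})\bigr)\longrightarrow0\quad\text{in probability.}$$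
   Context: Let $N\ge1$, $\mathcal N=\{1,\dots,N\}$. For $\mathcal S\subseteq\mathcal N$ write $x_{\mathcal S}=\{x_i: i\in\mathcal S\}$ (so $x=x_{\mathcal N}$), and $\pi(\mathcal S)$ for the set of all $|\mathcal S|!$ orderings $O=(O_1,\dots,O_{|\mathcal S|})$ of $\mathcal S$; $O_{1:k}$ denotes the first $k$ entries of $O$ ($O_{1:0}$ is empty). $\mathbb I$ is the indicator. Marginal contribution module: real numbers $\triangle(x_{j_k},x_{(j_1,\dots,j_{k-1})};\theta_\triangle)$, defined for every finite sequence $(j_1,\dots,j_k)$ of distinct indices (they may depend on the order of the prefix). With a fixed constant $\phi_0\in\mathbb R$, $f_c(x_{\mathcal S},O;\theta_\triangle)=\phi_0+\sum_{k=1}^{|\mathcal S|}\triangle(x_{O_k},x_{O_{1:k-1}};\theta_\triangle)$ for $O\in\pi(\mathcal S)$. Attribution network: for nonempty $\mathcal S\subseteq\mathcal N$ and $i\in\mathcal S$, a real number $\phi(x_{\mathcal S};\theta_\phi)_i$ differentiable in $\theta_\phi\in\mathbb R^p$. The final output is $f(x_{\mathcal S};\theta_\phi)=\phi_0+\sum_{i\in\mathcal S}\phi(x_{\mathcal S};\theta_\phi)_i$, with $f(x_\emptyset;\theta_\phi)=\phi_0$. Distillation loss: for a finite list $\mathcal D$ of permutations in $\pi(\mathcal S)$, $$L_s^{(i)}(x_{\mathcal S};\mathcal D)=\frac1{|\mathcal D|}\sum_{O\in\mathcal D}\Bigl(\phi(x_{\mathcal S};\theta_\phi)_i-\sum_{k=1}^{|\mathcal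 S|}\mathbb I\{O_k=i\}\triangle(x_i,x_{O_{1:k-1}};\theta_\triangle)\Bigr)^2,$$ where $\theta_\triangle$ is held fixed. Convention: optimizing a loss yields parameters at which its gradient in $\theta_\phi$ vanishes while the gradient of the corresponding network output does not. *)

theory Defs
  imports "HOL-Probability.Probability" "HOL-Combinatorics.Multiset_Permutations"
begin

text \<open>
  The index set \<open>{1,\<dots>,N}\<close> is the finite type \<open>'n\<close>, so \<open>N = CARD('n) \<ge> 1\<close> and \<open>x :: real ^ 'n\<close>.
  The orderings \<open>\<pi>(S)\<close> of a set \<open>S\<close> of indices are the elements of \<open>permutations_of_set S\<close>.
  Lists are indexed from 0, so the \<open>k\<close>-th entry (\<open>1 \<le> k\<close>) of an ordering \<open>r\<close> is \<open>r ! (k - 1)\<close>, and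
  the entries preceding \<open>r ! k\<close> form the prefix \<open>take k r\<close>.
\<close>

text \<open>A feature carries its index along with its value, so that features at different positions with
  equal values remain distinct.\<close>

definition feature :: "real ^ 'n \<Rightarrow> 'n \<Rightarrow> 'n \<times> real"
  where "feature x i = (i, x $ i)"

definition subinput :: "real ^ 'n \<Rightarrow> 'n set \<Rightarrow> ('n \<times> real) set"
  where "subinput x S = feature x ` S"

type_synonym ('n, 'q) marginal_module = "'n \<times> real \<Rightarrow> ('n \<times> real) list \<Rightarrow> 'q \<Rightarrow> real"

type_synonym ('n, 'p) attribution_network = "('n \<times> real) set \<Rightarrow> 'p \<Rightarrow> 'n \<Rightarrow> real"

text \<open>The output \<open>f\<^sub>c(x\<^sub>S, r; \<theta>\<^sub>\<Delta>)\<close> of the marginal contribution module, for an ordering \<open>r\<close> of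
  \<open>S = set r\<close>.\<close>

definition contribution_output ::
    "real \<Rightarrow> ('n, 'q) marginal_module \<Rightarrow> 'q \<Rightarrow> real ^ 'n \<Rightarrow> 'n list \<Rightarrow> real"
  where "contribution_output \<phi>0 \<Delta> \<theta>\<Delta> x r =
    \<phi>0 + (\<Sum>k<length r. \<Delta> (feature x (r ! k)) (map (feature x) (take k r)) \<theta>\<Delta>)"

text \<open>The output \<open>f(x\<^sub>S; \<theta>\<^sub>\<phi>)\<close>; for \<open>S = {}\<close> the sum is empty and the value is \<open>\<phi>\<^sub>0\<close>.\<close>

definition network_output ::
    "real \<Rightarrow> ('n, 'p) attribution_network \<Rightarrow> 'p \<Rightarrow> real ^ 'n \<Rightarrow> 'n set \<Rightarrow> real"
  where "network_output \<phi>0 \<phi> \<theta> x S = \<phi>0 + (\<Sum>i\<in>S. \<phi> (subinput x S) \<theta> i)"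

definition distillation_loss ::
    "('n, 'q) marginal_module \<Rightarrow> 'q \<Rightarrow> ('n, 'p) attribution_network \<Rightarrow> real ^ 'n \<Rightarrow>
     'n set \<Rightarrow> 'n \<Rightarrow> 'n list list \<Rightarrow> 'p \<Rightarrow> real"
  where "distillation_loss \<Delta> \<theta>\<Delta> \<phi> x S i D \<theta> =
    1 / real (length D) *
      (\<Sum>r\<leftarrow>D. (\<phi> (subinput x S) \<theta> i -
        (\<Sum>k<card S. of_bool (r ! k = i) * \<Delta> (feature x i) (map (feature x) (take k r)) \<theta>\<Delta>))\<^sup>2)"

definition shapley_value :: "('n::finite set \<Rightarrow> real) \<Rightarrow> 'n \<Rightarrow> real"
  where "shapley_value v i =
    1 / fact CARD('n) *
      (\<Sum>r\<in>permutations_of_set (UNIV :: 'n set). \<Sum>k<CARD('n).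
        of_bool (r ! k = i) * (v (set (take (Suc k) r)) - v (set (take k r))))"

text \<open>The measurability clause excludes that the probabilities below are \<open>0\<close> merely because
  \<open>measure\<close> vanishes on non-measurable sets.\<close>

definition converges_in_probability ::
    "'w measure \<Rightarrow> (nat \<Rightarrow> 'w \<Rightarrow> real) \<Rightarrow> real \<Rightarrow> bool"
  where "converges_in_probability P X c \<longleftrightarrow>
    (\<forall>\<^sub>F m in sequentially. X m \<in> borel_measurable P) \<and>
    (\<forall>\<epsilon>>0. (\<lambda>m. measure P {\<omega> \<in> space P. \<bar>X m \<omega> - c\<bar> > \<epsilon>}) \<longlonglongrightarrow> 0)"

end

theory Submission
  imports Defs
begin

text \<open>
  A stationary point of a quadratic loss in the value \<open>\<phi>(x\<^sub>S; \<theta>)\<^sub>i\<close> is the sample mean of the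
  contributions credited to \<open>i\<close> along the drawn orderings. Summed over \<open>i \<in> S\<close>, the contributions
  credited along one ordering \<open>r\<close> give \<open>f\<^sub>c(x\<^sub>S, r) - \<phi>\<^sub>0\<close>, which does not depend on \<open>r\<close>; hence the
  network output equals \<open>f\<^sub>c\<close> almost surely, already for finite \<open>M\<close>. The Shapley value of
  \<open>f = f\<^sub>c\<close> is then the mean, over all orderings, of the contribution credited to \<open>i\<close>, and the weak
  law of large numbers is needed for the full index set only.
\<close>

text \<open>The inner sum of \<open>distillation_loss\<close>, that is, the regression target for
  \<open>\<phi>\<close> along one ordering. The length \<open>n\<close> is an argument so that the
  same term matches the loss, with \<open>n = card S\<close>, and the Shapley sum, with
  \<open>n = CARD('n)\<close>.\<close>

definition credit ::
    "('n, 'q) marginal_module \<Rightarrow> 'q \<Rightarrow> real ^ 'n \<Rightarrow> nat \<Rightarrow> 'n \<Rightarrow> 'n list \<Rightarrow> real"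
  where "credit \<Delta> \<theta>\<Delta> x n i r =
    (\<Sum>k<n. of_bool (r ! k = i) * \<Delta> (feature x i) (map (feature x) (take k r)) \<theta>\<Delta>)"

text \<open>Each position of \<open>r\<close> holds exactly one index of \<open>S\<close>, so after
  exchanging the sums the indicator leaves one term per position, the one in
  \<open>contribution_output\<close>.\<close>

lemma sum_credit:
  assumes "r \<in> permutations_of_set S"
  shows "(\<Sum>i\<in>S. credit \<Delta> \<theta>\<Delta> x (card S) i r) = contribution_output \<phi>0 \<Delta> \<theta>\<Delta> x r - \<phi>0"
proof -
  have len: "length r = card S"
    using assms by (rule length_finite_permutations_of_set)
  have S: "set r = S"
    using assms by (rule permutations_of_setD)
  have fin: "finite S"
    using S by auto
  have "(\<Sum>i\<in>S. credit \<Delta> \<theta>\<Delta> x (card S) i r) =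
      (\<Sum>k<card S. \<Sum>i\<in>S. of_bool (r ! k = i) * \<Delta> (feature x i) (map (feature x) (take k r)) \<theta>\<Delta>)"
    unfolding credit_def by (rule sum.swap)
  also have "\<dots> = (\<Sum>k<card S. \<Delta> (feature x (r ! k)) (map (feature x) (take k r)) \<theta>\<Delta>)"
  proof (rule sum.cong)
    fix k assume "k \<in> {..<card S}"
    then have "r ! k \<in> S"
      using len S by auto
    with fin show "(\<Sum>i\<in>S. of_bool (r ! k = i) * \<Delta> (feature x i) (map (feature x) (take k r)) \<theta>\<Delta>) =
        \<Delta> (feature x (r ! k)) (map (feature x) (take k r)) \<theta>\<Delta>"
      by (simp add: of_bool_def if_distrib[of "\<lambda>c. c * _"] sum.delta cong: if_cong)
  qed simp
  finally show ?thesis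
    by (simp add: contribution_output_def len)
qed

text \<open>Prefixes of an ordering are distinct lists, so the hypothesis evaluates \<open>v\<close>
  on them. Two consecutive values differ by the last summand of the longer prefix, where the
  indicator turns \<open>r ! k\<close> into \<open>i\<close>.\<close>

lemma shapley_value_eq_mean_credit:
  fixes x :: "real ^ 'n::finite"
  assumes "\<And>r. distinct r \<Longrightarrow> v (set r) = contribution_output \<phi>0 \<Delta> \<theta>\<Delta> x r"
  shows "shapley_value v i =
    (\<Sum>r\<in>permutations_of_set UNIV. credit \<Delta> \<theta>\<Delta> x CARD('n) i r) / fact CARD('n)"
proof -
  have "of_bool (r ! k = i) * (v (set (take (Suc k) r)) - v (set (take k r))) =
      of_bool (r ! k = i) * \<Delta> (feature x i) (map (feature x) (take k r)) \<theta>\<Delta>"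
    if "r \<in> permutations_of_set UNIV" "k < CARD('n)" for r :: "'n list" and k
  proof -
    have d: "distinct r" and len: "length r = CARD('n)"
      using that permutations_of_setD length_finite_permutations_of_set by blast+
    have "length (take (Suc k) r) = Suc k" "length (take k r) = k"
      using len \<open>k < CARD('n)\<close> by simp_all
    \<comment> \<open>The output of a prefix refers to prefixes of that prefix; reading them off
      \<open>r\<close> itself makes all but the last summand cancel.\<close>
    moreover have "take j (take (Suc k) r) = take j r" "take (Suc k) r ! j = r ! j" if "j \<le> k" for j
      using that by (simp_all add: min_def)
    moreover have "take j (take k r) = take j r" "take k r ! j = r ! j" if "j < k" for j
      using that by (simp_all add: min_def)
    ultimately show ?thesis
      using d by (auto simp add: assms contribution_output_def simp del: take_take)
  qed
  then show ?thesis
    by (simp add: shapley_value_def credit_def)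
qed

text \<open>By the chain rule the gradient of the loss is a scalar, proportional to the sum of the
  residuals, times the gradient \<open>g\<close> of \<open>u\<close>. As \<open>g\<close> is
  nonzero, the residuals must sum to zero.\<close>

lemma GDERIV_mean_squares_zero:
  fixes u :: "'a::real_inner \<Rightarrow> real"
  assumes zero: "GDERIV (\<lambda>t. 1 / real (length D) * (\<Sum>r\<leftarrow>D. (u t - a r)\<^sup>2)) t0 :> 0"
    and u: "GDERIV u t0 :> g" and "g \<noteq> 0" and "D \<noteq> []"
  shows "u t0 = (\<Sum>r\<leftarrow>D. a r) / real (length D)"
proof -
  \<comment> \<open>The induction runs over an arbitrary list \<open>E\<close> without the weight,
    which depends on the length of \<open>D\<close> and is attached afterwards.\<close>
  have "GDERIV (\<lambda>t. \<Sum>r\<leftarrow>E. (u t - a r)\<^sup>2) t0 :> (2 * (\<Sum>r\<leftarrow>E. u t0 - a r)) *\<^sub>R g" for E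
  proof (induction E)
    case Nil
    then show ?case by (simp add: GDERIV_const)
  next
    case (Cons r E)
    have "GDERIV (\<lambda>t. (u t - a r)\<^sup>2) t0 :> (2 * (u t0 - a r)) *\<^sub>R g"
      by (rule GDERIV_DERIV_compose[OF u]) (auto intro!: derivative_eq_intros)
    from GDERIV_add[OF this Cons] show ?case
      by (simp add: algebra_simps)
  qed
  from GDERIV_mult[OF GDERIV_const[of "1 / real (length D)"] this[of D]]
  have "GDERIV (\<lambda>t. 1 / real (length D) * (\<Sum>r\<leftarrow>D. (u t - a r)\<^sup>2)) t0 :>
      (1 / real (length D)) *\<^sub>R (2 * (\<Sum>r\<leftarrow>D. u t0 - a r)) *\<^sub>R g"
    by simp
  with zero have "(\<lambda>h. h \<bullet> 0) =
      (\<lambda>h. h \<bullet> ((1 / real (length D)) *\<^sub>R (2 * (\<Sum>r\<leftarrow>D. u t0 - a r)) *\<^sub>R g))"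
    unfolding gderiv_def by (rule has_derivative_unique)
  \<comment> \<open>Two linear functionals coincide; their values at \<open>g\<close> leave the
    scalar factor times \<open>g \<bullet> g\<close>, which is positive.\<close>
  then have "g \<bullet> ((1 / real (length D)) *\<^sub>R (2 * (\<Sum>r\<leftarrow>D. u t0 - a r)) *\<^sub>R g) = 0"
    by (metis inner_zero_right)
  then have "(\<Sum>r\<leftarrow>D. u t0 - a r) = 0"
    using \<open>g \<noteq> 0\<close> \<open>D \<noteq> []\<close> by simp
  then show ?thesis
    using \<open>D \<noteq> []\<close> by (simp add: sum_list_subtractf sum_list_triv field_simps)
qed

text \<open>The draws form a triangular array: each row \<open>m\<close> is i.i.d., but rows need
  not extend one another, so a law for one fixed sequence does not apply. Hoeffding's inequality
  bounds every row on its own, with a tail that vanishes as \<open>m\<close> grows.\<close>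

lemma weak_law_iid_bounded:
  fixes Z :: "nat \<Rightarrow> nat \<Rightarrow> 'w \<Rightarrow> 'b" and a :: "'b \<Rightarrow> real"
  assumes "prob_space P"
    and indep: "\<And>m. m \<ge> 1 \<Longrightarrow>
      prob_space.indep_vars P (\<lambda>_. count_space UNIV) (Z m) {..<m}"
    and distr: "\<And>m j. m \<ge> 1 \<Longrightarrow> j < m \<Longrightarrow> distr P (count_space UNIV) (Z m j) = measure_pmf p"
    and bound: "\<And>r. r \<in> set_pmf p \<Longrightarrow> \<bar>a r\<bar> \<le> B"
  shows "converges_in_probability P (\<lambda>m \<omega>. (\<Sum>j<m. a (Z m j \<omega>)) / real m)
    (measure_pmf.expectation p a)"
proof -
  interpret prob_space P by fact
  have Z[measurable]: "Z m j \<in> measurable P (count_space UNIV)" if "j < m" for m j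
  proof -
    have "m \<ge> 1" using that by simp
    from indep[OF this] that show ?thesis
      unfolding indep_vars_def by auto
  qed
  have mean_measurable: "(\<lambda>\<omega>. (\<Sum>j<m. a (Z m j \<omega>)) / real m) \<in> borel_measurable P" for m
    by (intro borel_measurable_divide borel_measurable_sum measurable_compose[OF Z]) auto
  \<comment> \<open>Adding 1 keeps the range nondegenerate even if the bound is 0, so that the
    denominator in Hoeffding's inequality is positive.\<close>
  define C where "C = \<bar>B\<bar> + 1"
  have "C > 0" by (simp add: C_def add_nonneg_pos)
  \<comment> \<open>A deviation of the mean by \<epsilon> is one of the sum by
    \<open>m * \<epsilon>\<close>; the squared widths add up to \<open>4 * m * C\<^sup>2\<close>,
    whence this exponent.\<close>
  have tail: "prob {\<omega> \<in> space P. \<bar>(\<Sum>j<m. a (Z m j \<omega>)) / real m - measure_pmf.expectation p a\<bar> > \<epsilon>}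
      \<le> 2 * exp (- (\<epsilon>\<^sup>2 / (2 * C\<^sup>2)) * real m)" if "m \<ge> 1" "\<epsilon> > 0" for m \<epsilon>
  proof -
    have ev: "expectation (\<lambda>\<omega>. a (Z m j \<omega>)) = measure_pmf.expectation p a" if "j < m" for j
      using integral_distr[OF Z[OF that], of a] distr[OF \<open>m \<ge> 1\<close> that] by simp
    interpret Hoeffding_ineq P "{..<m}" "\<lambda>j \<omega>. a (Z m j \<omega>)" "\<lambda>_. - C" "\<lambda>_. C"
      "\<Sum>j<m. expectation (\<lambda>\<omega>. a (Z m j \<omega>))"
    proof unfold_locales
      show "indep_vars (\<lambda>_. borel) (\<lambda>j \<omega>. a (Z m j \<omega>)) {..<m}"
        by (rule indep_vars_compose2[OF indep[OF \<open>m \<ge> 1\<close>]]) auto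
      fix j assume "j \<in> {..<m}"
      then have j: "j < m" by simp
      \<comment> \<open>The bound is known on the support of \<open>p\<close> only; it holds almost
        surely under the law of \<open>Z m j\<close> and is pulled back to \<open>P\<close>.\<close>
      have "AE r in distr P (count_space UNIV) (Z m j). a r \<in> {- C..C}"
        unfolding distr[OF \<open>m \<ge> 1\<close> j] using bound
        by (auto simp: AE_measure_pmf_iff C_def abs_le_iff dest!: bound)
      then show "AE \<omega> in P. a (Z m j \<omega>) \<in> {- C..C}"
        by (subst (asm) AE_distr_iff) (use Z[OF j] in auto)
    qed simp_all
    have "{\<omega> \<in> space P. \<bar>(\<Sum>j<m. a (Z m j \<omega>)) / real m - measure_pmf.expectation p a\<bar> > \<epsilon>} \<subseteq>
        {\<omega> \<in> space P. \<bar>(\<Sum>j<m. a (Z m j \<omega>)) - (\<Sum>j<m. expectation (\<lambda>\<omega>. a (Z m j \<omega>)))\<bar> \<ge> real m * \<epsilon>}"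
    proof safe
      fix \<omega> assume "\<bar>(\<Sum>j<m. a (Z m j \<omega>)) / real m - measure_pmf.expectation p a\<bar> > \<epsilon>"
      then have "real m * \<epsilon> \<le> real m * \<bar>(\<Sum>j<m. a (Z m j \<omega>)) / real m - measure_pmf.expectation p a\<bar>"
        by (intro mult_left_mono) auto
      also have "\<dots> = \<bar>real m * ((\<Sum>j<m. a (Z m j \<omega>)) / real m - measure_pmf.expectation p a)\<bar>"
        by (simp add: abs_mult)
      also have "real m * ((\<Sum>j<m. a (Z m j \<omega>)) / real m - measure_pmf.expectation p a) =
          (\<Sum>j<m. a (Z m j \<omega>)) - (\<Sum>j<m. expectation (\<lambda>\<omega>. a (Z m j \<omega>)))"
        using \<open>m \<ge> 1\<close> by (simp add: ev right_diff_distrib)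
      finally show "real m * \<epsilon> \<le>
          \<bar>(\<Sum>j<m. a (Z m j \<omega>)) - (\<Sum>j<m. expectation (\<lambda>\<omega>. a (Z m j \<omega>)))\<bar>" .
    qed
    then have "prob {\<omega> \<in> space P. \<bar>(\<Sum>j<m. a (Z m j \<omega>)) / real m - measure_pmf.expectation p a\<bar> > \<epsilon>} \<le>
        prob {\<omega> \<in> space P. \<bar>(\<Sum>j<m. a (Z m j \<omega>)) - (\<Sum>j<m. expectation (\<lambda>\<omega>. a (Z m j \<omega>)))\<bar> \<ge> real m * \<epsilon>}"
      by (intro finite_measure_mono) auto
    also have "\<dots> \<le> 2 * exp (- 2 * (real m * \<epsilon>)\<^sup>2 / (\<Sum>j<m. (C - - C)\<^sup>2))"
      using \<open>C > 0\<close> that by (intro Hoeffding_ineq_abs_ge) auto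
    also have "- 2 * (real m * \<epsilon>)\<^sup>2 / (\<Sum>j<m. (C - - C)\<^sup>2) = - (\<epsilon>\<^sup>2 / (2 * C\<^sup>2)) * real m"
      using \<open>C > 0\<close> that by (simp add: field_simps power2_eq_square)
    finally show ?thesis .
  qed
  show ?thesis
    unfolding converges_in_probability_def
  proof (intro conjI allI impI)
    fix \<epsilon> :: real assume "\<epsilon> > 0"
    define c where "c = \<epsilon>\<^sup>2 / (2 * C\<^sup>2)"
    have "c > 0" using \<open>\<epsilon> > 0\<close> \<open>C > 0\<close> by (simp add: c_def)
    have "filterlim (\<lambda>m. - c * real m) at_bot sequentially"
      using \<open>c > 0\<close> filterlim_real_sequentially
      by (intro filterlim_tendsto_neg_mult_at_bot[OF tendsto_const]) auto
    then have "(\<lambda>m. 2 * exp (- c * real m)) \<longlonglongrightarrow> 0"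
      by (intro tendsto_mult_right_zero filterlim_compose[OF exp_at_bot])
    then show "(\<lambda>m. prob {\<omega> \<in> space P.
        \<bar>(\<Sum>j<m. a (Z m j \<omega>)) / real m - measure_pmf.expectation p a\<bar> > \<epsilon>}) \<longlonglongrightarrow> 0"
    proof (rule Lim_null_comparison[rotated])
      show "\<forall>\<^sub>F m in sequentially. norm (prob {\<omega> \<in> space P.
          \<bar>(\<Sum>j<m. a (Z m j \<omega>)) / real m - measure_pmf.expectation p a\<bar> > \<epsilon>}) \<le>
          2 * exp (- c * real m)"
        using tail[OF _ \<open>\<epsilon> > 0\<close>] unfolding c_def
        by (intro eventually_sequentiallyI[of 1]) simp
    qed
  qed (simp add: mean_measurable)
qed

text \<open>Deviation events that agree up to a null set have equal measure. Only centred variables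
  are compared, so the two limits may differ. Measurability of \<open>X\<close> is a separate
  assumption because almost sure equality does not transfer it on an incomplete space.\<close>

lemma converges_in_probability_AE_cong:
  assumes Y: "converges_in_probability P Y c"
    and X: "\<forall>\<^sub>F m in sequentially. X m \<in> borel_measurable P"
    and eq: "\<forall>\<^sub>F m in sequentially. AE \<omega> in P. X m \<omega> - d = Y m \<omega> - c"
  shows "converges_in_probability P X d"
  unfolding converges_in_probability_def
proof (intro conjI allI impI X)
  fix \<epsilon> :: real assume "\<epsilon> > 0"
  have "\<forall>\<^sub>F m in sequentially. measure P {\<omega> \<in> space P. \<bar>Y m \<omega> - c\<bar> > \<epsilon>} =
      measure P {\<omega> \<in> space P. \<bar>X m \<omega> - d\<bar> > \<epsilon>}"
  proof -
    have "\<forall>\<^sub>F m in sequentially. Y m \<in> borel_measurable P"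
      using Y by (simp add: converges_in_probability_def)
    with X eq show ?thesis
    proof eventually_elim
      case (elim m)
      note [measurable] = elim(1,3)
      show ?case
        by (rule measure_eq_AE) (use elim(2) in \<open>auto elim!: eventually_mono\<close>)
    qed
  qed
  moreover have "(\<lambda>m. measure P {\<omega> \<in> space P. \<bar>Y m \<omega> - c\<bar> > \<epsilon>}) \<longlonglongrightarrow> 0"
    using Y \<open>\<epsilon> > 0\<close> by (simp add: converges_in_probability_def)
  ultimately show "(\<lambda>m. measure P {\<omega> \<in> space P. \<bar>X m \<omega> - d\<bar> > \<epsilon>}) \<longlonglongrightarrow> 0"
    by (rule Lim_transform_eventually[rotated])
qed

theorem theorem3p4:
  fixes x :: "real ^ 'n::finite"
    and \<phi>0 :: real
    and \<Delta> :: "('n, 'q) marginal_module"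
    and \<theta>\<Delta> :: 'q
    and \<phi> :: "('n, real ^ 'p::finite) attribution_network"
    and P :: "'w measure"
    and draw :: "nat \<Rightarrow> 'n set \<Rightarrow> nat \<Rightarrow> 'w \<Rightarrow> 'n list"
    and \<theta> :: "nat \<Rightarrow> 'w \<Rightarrow> real ^ 'p"
  defines "D \<equiv> \<lambda>M S \<omega>. map (\<lambda>j. draw M S j \<omega>) [0..<M]"
  assumes differentiable:
      "\<And>S i t. S \<noteq> {} \<Longrightarrow> i \<in> S \<Longrightarrow> (\<lambda>t. \<phi> (subinput x S) t i) differentiable (at t)"
    and order_independent:
      "\<And>S r1 r2. S \<noteq> {} \<Longrightarrow> r1 \<in> permutations_of_set S \<Longrightarrow> r2 \<in> permutations_of_set S \<Longrightarrow>
        contribution_output \<phi>0 \<Delta> \<theta>\<Delta> x r1 = contribution_output \<phi>0 \<Delta> \<theta>\<Delta> x r2"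
    and prob_space: "prob_space P"
    and independent:
      "\<And>M S. M \<ge> 1 \<Longrightarrow> S \<noteq> {} \<Longrightarrow>
        prob_space.indep_vars P (\<lambda>_. count_space UNIV) (draw M S) {..<M}"
    and uniform:
      "\<And>M S j. M \<ge> 1 \<Longrightarrow> S \<noteq> {} \<Longrightarrow> j < M \<Longrightarrow>
        distr P (count_space UNIV) (draw M S j) = measure_pmf (pmf_of_set (permutations_of_set S))"
    and random_parameter: "\<And>M. M \<ge> 1 \<Longrightarrow> \<theta> M \<in> borel_measurable P"
    and optimized:
      "\<And>M. M \<ge> 1 \<Longrightarrow> AE \<omega> in P. \<forall>S i. S \<noteq> {} \<longrightarrow> i \<in> S \<longrightarrow>
        (GDERIV (distillation_loss \<Delta> \<theta>\<Delta> \<phi> x S i (D M S \<omega>)) (\<theta> M \<omega>) :> 0) \<and>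
        (\<exists>g. g \<noteq> 0 \<and> (GDERIV (\<lambda>t. \<phi> (subinput x S) t i) (\<theta> M \<omega>) :> g))"
  shows "\<forall>i. converges_in_probability P
    (\<lambda>M \<omega>. \<phi> (subinput x UNIV) (\<theta> M \<omega>) i - shapley_value (network_output \<phi>0 \<phi> (\<theta> M \<omega>) x) i) 0"
proof
  fix i :: 'n
  interpret prob_space P by fact
  define c where "c S = credit \<Delta> \<theta>\<Delta> x (card S)" for S :: "'n set"
  \<comment> \<open>Differentiability in the parameter enters here: it gives continuity, hence a
    Borel function of the random parameter.\<close>
  have \<phi>_measurable: "(\<lambda>\<omega>. \<phi> (subinput x S) (\<theta> M \<omega>) j) \<in> borel_measurable P"
    if "M \<ge> 1" "j \<in> S" for M S j
  proof -
    have "continuous_on UNIV (\<lambda>t. \<phi> (subinput x S) t j)"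
      using differentiable[of S j] that
      by (auto simp: continuous_on_eq_continuous_at intro!: differentiable_imp_continuous_within)
    then show ?thesis
      by (rule measurable_compose[OF random_parameter[OF \<open>M \<ge> 1\<close>] borel_measurable_continuous_onI])
  qed
  have measurable: "(\<lambda>\<omega>. \<phi> (subinput x UNIV) (\<theta> M \<omega>) i -
      shapley_value (network_output \<phi>0 \<phi> (\<theta> M \<omega>) x) i) \<in> borel_measurable P"
    if "M \<ge> 1" for M
    unfolding shapley_value_def network_output_def using \<phi>_measurable[OF that]
    by (intro borel_measurable_diff borel_measurable_times borel_measurable_sum
        borel_measurable_add borel_measurable_const) auto
  \<comment> \<open>There are finitely many \<open>S\<close> and finitely many \<open>j < M\<close>,
    so one null set serves for all of them.\<close>
  have draws: "AE \<omega> in P. \<forall>S. S \<noteq> {} \<longrightarrow> (\<forall>j<M. draw M S j \<omega> \<in> permutations_of_set S)"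
    if "M \<ge> 1" for M
  proof -
    have "AE \<omega> in P. draw M S j \<omega> \<in> permutations_of_set S" if "S \<noteq> {}" "j < M" for S j
    proof -
      have Z: "draw M S j \<in> measurable P (count_space UNIV)"
        using independent[OF \<open>M \<ge> 1\<close> \<open>S \<noteq> {}\<close>] \<open>j < M\<close> unfolding indep_vars_def by auto
      have "AE r in distr P (count_space UNIV) (draw M S j). r \<in> permutations_of_set S"
        unfolding uniform[OF \<open>M \<ge> 1\<close> that] by (auto simp: AE_measure_pmf_iff set_pmf_of_set)
      then show ?thesis
        by (subst (asm) AE_distr_iff) (use Z in auto)
    qed
    then have "AE \<omega> in P. \<forall>S\<in>UNIV. S \<noteq> {} \<longrightarrow> (\<forall>j\<in>{..<M}. draw M S j \<omega> \<in> permutations_of_set S)"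
      by (intro AE_finite_allI AE_impI) auto
    then show ?thesis by (simp add: Ball_def)
  qed
  \<comment> \<open>The identity is exact for each \<open>M \<ge> 1\<close>; only the sample mean on
    the right still has to converge. The \<open>- 0\<close> matches the centred form of
    \<open>converges_in_probability_AE_cong\<close>.\<close>
  have mean: "AE \<omega> in P.
      \<phi> (subinput x UNIV) (\<theta> M \<omega>) i - shapley_value (network_output \<phi>0 \<phi> (\<theta> M \<omega>) x) i - 0 =
      (\<Sum>j<M. c UNIV i (draw M UNIV j \<omega>)) / real M -
      measure_pmf.expectation (pmf_of_set (permutations_of_set UNIV)) (c UNIV i)"
    if M: "M \<ge> 1" for M
    using optimized[OF M] draws[OF M]
  proof eventually_elim
    case (elim \<omega>)
    \<comment> \<open>All \<open>S\<close> are covered, since the Shapley value evaluates the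
      network on every prefix of every ordering.\<close>
    have \<phi>_eq: "\<phi> (subinput x S) (\<theta> M \<omega>) k = (\<Sum>j<M. c S k (draw M S j \<omega>)) / real M"
      if k: "k \<in> S" for S k
    proof -
      have "S \<noteq> {}" using k by auto
      with elim(1) k obtain g where
        "GDERIV (distillation_loss \<Delta> \<theta>\<Delta> \<phi> x S k (D M S \<omega>)) (\<theta> M \<omega>) :> 0"
        "g \<noteq> 0" "GDERIV (\<lambda>t. \<phi> (subinput x S) t k) (\<theta> M \<omega>) :> g"
        by blast
      moreover have "D M S \<omega> \<noteq> []"
        using M by (simp add: D_def)
      ultimately have "\<phi> (subinput x S) (\<theta> M \<omega>) k =
          (\<Sum>r\<leftarrow>D M S \<omega>. c S k r) / real (length (D M S \<omega>))"
        by (intro GDERIV_mean_squares_zero)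
          (auto simp: distillation_loss_def[abs_def] c_def credit_def)
      then show ?thesis
        by (simp add: D_def o_def interv_sum_list_conv_sum_set_nat atLeast0LessThan)
    qed
    \<comment> \<open>Every draw from the orderings of \<open>set r\<close> distributes the same
      total among the indices, so averaging over the draws leaves no sampling error in the network
      output.\<close>
    have "network_output \<phi>0 \<phi> (\<theta> M \<omega>) x (set r) = contribution_output \<phi>0 \<Delta> \<theta>\<Delta> x r"
      if "distinct r" for r
    \<comment> \<open>The empty prefix is separate because the assumptions speak of nonempty sets;
      both outputs are then \<open>\<phi>0\<close>.\<close>
    proof (cases "r = []")
      case True
      then show ?thesis
        by (simp add: network_output_def contribution_output_def)
    next
      case False
      then have ne: "set r \<noteq> {}" by simp
      have r: "r \<in> permutations_of_set (set r)"
        using that by auto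
      have "(\<Sum>k\<in>set r. c (set r) k (draw M (set r) j \<omega>)) = contribution_output \<phi>0 \<Delta> \<theta>\<Delta> x r - \<phi>0"
        if "j < M" for j
      proof -
        have "draw M (set r) j \<omega> \<in> permutations_of_set (set r)"
          using elim(2) ne that by blast
        \<comment> \<open>The offset occurs only on the right of \<open>sum_credit\<close>, so
          rewriting from left to right requires it to be instantiated.\<close>
        with order_independent[OF ne this r] show ?thesis
          unfolding c_def by (subst sum_credit[where ?\<phi>0.0 = \<phi>0]) auto
      qed
      then have "(\<Sum>k\<in>set r. \<Sum>j<M. c (set r) k (draw M (set r) j \<omega>)) =
          real M * (contribution_output \<phi>0 \<Delta> \<theta>\<Delta> x r - \<phi>0)"
        by (subst sum.swap) simp
      then show ?thesis
        using M by (simp add: network_output_def \<phi>_eq flip: sum_divide_distrib)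
    qed
    then have "shapley_value (network_output \<phi>0 \<phi> (\<theta> M \<omega>) x) i =
        (\<Sum>r\<in>permutations_of_set UNIV. c UNIV i r) / fact CARD('n)"
      unfolding c_def by (rule shapley_value_eq_mean_credit)
    \<comment> \<open>The uniform expectation is the average over all orderings, whose number is
      \<open>fact CARD('n)\<close>.\<close>
    then show ?case
      by (simp add: \<phi>_eq integral_pmf_of_set)
  qed
  \<comment> \<open>The orderings form a finite set, so the sum of all absolute values dominates
    each of them.\<close>
  define B where "B = (\<Sum>r\<in>permutations_of_set UNIV. \<bar>c UNIV i r\<bar>)"
  have "\<bar>c UNIV i r\<bar> \<le> B" if "r \<in> set_pmf (pmf_of_set (permutations_of_set UNIV))" for r
    unfolding B_def using that by (intro member_le_sum) (auto simp: set_pmf_of_set)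
  then have "converges_in_probability P (\<lambda>M \<omega>. (\<Sum>j<M. c UNIV i (draw M UNIV j \<omega>)) / real M)
      (measure_pmf.expectation (pmf_of_set (permutations_of_set UNIV)) (c UNIV i))"
    using independent uniform by (intro weak_law_iid_bounded \<open>prob_space P\<close>) auto
  then show "converges_in_probability P
    (\<lambda>M \<omega>. \<phi> (subinput x UNIV) (\<theta> M \<omega>) i - shapley_value (network_output \<phi>0 \<phi> (\<theta> M \<omega>) x) i) 0"
    by (rule converges_in_probability_AE_cong)
      (use measurable mean in \<open>auto intro!: eventually_sequentiallyI[of 1]\<close>)
qed

end
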